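(* Let $G$ be a $2$-connected nontrivial uniquely $C_9$-saturated graph, let $C$ be a longest even cycle among the even cycles of $G$ of length at most $12$, assumed to have length $8$, and let $R=V(G)\setminus V(C)$. Let $x\in R$ and $S=N(x)\cap V(C)$. Then (i) $G[C]$ has no Hamiltonian path whose two ends both lie in $S$; and (ii) for every $w\in V(C)\setminus S$, $G[C]$ has at most one Hamiltonian path with one end $w$ and the other end in $S$.
   Context: All graphs are finite and simple. A graph $G$ is uniquely $C_9$-saturated if it contains no cycle of length $9$ and, for every edge $e$ of the complement $\overline{G}$, $G+e$ contains exactly one cycle of length $9$; it is nontrivial if $|V(G)|\ge 9$. $G[C]$ denotes the subgraph of $G$ induced on $V(C)$. Hamiltonian paths are counted as subgraphs (undirected), and in (ii) the count is over all possible other ends in $S$ together. *)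

theory Defs
  imports Main
begin

record 'a graph =
  verts :: "'a set"
  edges :: "'a set set"

definition simple_graph :: "'a graph \<Rightarrow> bool" where
  "simple_graph G \<longleftrightarrow> finite (verts G) \<and> (\<forall>e\<in>edges G. e \<subseteq> verts G \<and> card e = 2)"

definition subgraph :: "'a graph \<Rightarrow> 'a graph \<Rightarrow> bool" where
  "subgraph H G \<longleftrightarrow> verts H \<subseteq> verts G \<and> edges H \<subseteq> edges G"

definition induced :: "'a graph \<Rightarrow> 'a set \<Rightarrow> 'a graph" where
  "induced G X = \<lparr>verts = verts G \<inter> X, edges = {e \<in> edges G. e \<subseteq> X}\<rparr>"

definition complement :: "'a graph \<Rightarrow> 'a graph" where
  "complement G = \<lparr>verts = verts G,
     edges = {e. e \<subseteq> verts G \<and> card e = 2 \<and> e \<notin> edges G}\<rparr>"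

definition add_edge :: "'a graph \<Rightarrow> 'a set \<Rightarrow> 'a graph" where
  "add_edge G e = G\<lparr>edges := insert e (edges G)\<rparr>"

definition neighbours :: "'a graph \<Rightarrow> 'a \<Rightarrow> 'a set" where
  "neighbours G x = {y. {x, y} \<in> edges G}"

text \<open>
  Paths and cycles are themselves graphs, so that counting them counts subgraphs: a list,
  its reversal and (for cycles) its rotations all determine the same path or cycle.
\<close>

definition path_graph :: "'a list \<Rightarrow> 'a graph" where
  "path_graph vs = \<lparr>verts = set vs,
     edges = {{vs ! i, vs ! Suc i} | i. Suc i < length vs}\<rparr>"

definition cycle_graph :: "'a list \<Rightarrow> 'a graph" where
  "cycle_graph vs = \<lparr>verts = set vs,
     edges = {{vs ! i, vs ! (Suc i mod length vs)} | i. i < length vs}\<rparr>"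

definition is_path :: "'a graph \<Rightarrow> 'a \<Rightarrow> 'a \<Rightarrow> bool" where
  "is_path P u v \<longleftrightarrow>
     (\<exists>vs. vs \<noteq> [] \<and> distinct vs \<and> hd vs = u \<and> last vs = v \<and> P = path_graph vs)"

definition is_cycle :: "'a graph \<Rightarrow> bool" where
  "is_cycle C \<longleftrightarrow> (\<exists>vs. distinct vs \<and> length vs \<ge> 3 \<and> C = cycle_graph vs)"

definition cycle_length :: "'a graph \<Rightarrow> nat" where
  "cycle_length C = card (edges C)"

definition cycle_in :: "'a graph \<Rightarrow> 'a graph \<Rightarrow> bool" where
  "cycle_in G C \<longleftrightarrow> is_cycle C \<and> subgraph C G"

text \<open>\<open>hamiltonian_path H P u v\<close>: \<open>P\<close> is a Hamiltonian path of \<open>H\<close> with ends \<open>u\<close> and \<open>v\<close>.\<close>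

definition hamiltonian_path :: "'a graph \<Rightarrow> 'a graph \<Rightarrow> 'a \<Rightarrow> 'a \<Rightarrow> bool" where
  "hamiltonian_path H P u v \<longleftrightarrow> is_path P u v \<and> subgraph P H \<and> verts P = verts H"

definition connected_graph :: "'a graph \<Rightarrow> bool" where
  "connected_graph G \<longleftrightarrow> verts G \<noteq> {} \<and>
     (\<forall>u\<in>verts G. \<forall>v\<in>verts G. \<exists>P. is_path P u v \<and> subgraph P G)"

definition k_connected :: "nat \<Rightarrow> 'a graph \<Rightarrow> bool" where
  "k_connected k G \<longleftrightarrow> card (verts G) > k \<and>
     (\<forall>X \<subseteq> verts G. card X < k \<longrightarrow> connected_graph (induced G (verts G - X)))"

definition uniquely_cycle_saturated :: "nat \<Rightarrow> 'a graph \<Rightarrow> bool" where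
  "uniquely_cycle_saturated k G \<longleftrightarrow>
     (\<nexists>C. cycle_in G C \<and> cycle_length C = k) \<and>
     (\<forall>e\<in>edges (complement G). \<exists>!C. cycle_in (add_edge G e) C \<and> cycle_length C = k)"

definition longest_even_cycle_upto :: "nat \<Rightarrow> 'a graph \<Rightarrow> 'a graph \<Rightarrow> bool" where
  "longest_even_cycle_upto m G C \<longleftrightarrow>
     cycle_in G C \<and> even (cycle_length C) \<and> cycle_length C \<le> m \<and>
     (\<forall>D. cycle_in G D \<and> even (cycle_length D) \<and> cycle_length D \<le> m
        \<longrightarrow> cycle_length D \<le> cycle_length C)"

end

theory Submission
  imports Defs
begin

text \<open>
  The vertex \<open>x\<close> lies off \<open>C\<close>, so a Hamiltonian path \<open>P\<close> of \<open>G[C]\<close>, which has \<open>8\<close> vertices, closes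
  up through \<open>x\<close> to a cycle on \<open>9\<close> vertices as soon as both ends of \<open>P\<close> are joined to \<open>x\<close>
  (\<open>is_cycle_close_path\<close>, \<open>cycle_length_close_path\<close>). If both ends lie in \<open>S\<close>, this is a
  \<open>9\<close>-cycle of \<open>G\<close>, which saturation forbids. If only one end lies in \<open>S\<close> and the other is
  \<open>w \<notin> S\<close>, then \<open>xw\<close> is an edge of the complement and the closed-up path is a \<open>9\<close>-cycle of
  \<open>G + xw\<close>. There is only one such cycle, and \<open>P\<close> is recovered from it by deleting \<open>x\<close>, wherever
  the end in \<open>S\<close> may be (\<open>close_path_inject\<close>); hence there is at most one such path.
\<close>

lemma edges_cycle_graph_image:
  "edges (cycle_graph vs) = (\<lambda>i. {vs ! i, vs ! (Suc i mod length vs)}) ` {..<length vs}"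
  by (auto simp: cycle_graph_def)

lemma cycle_length_cycle_graph:
  assumes "distinct vs" and "length vs \<ge> 3"
  shows "cycle_length (cycle_graph vs) = length vs"
proof -
  let ?n = "length vs"
  have "inj_on (\<lambda>i. {vs ! i, vs ! (Suc i mod ?n)}) {..<?n}"
  proof (rule inj_onI)
    fix i j
    assume i: "i \<in> {..<?n}" and j: "j \<in> {..<?n}"
      and eq: "{vs ! i, vs ! (Suc i mod ?n)} = {vs ! j, vs ! (Suc j mod ?n)}"
    have less: "Suc i mod ?n < ?n" "Suc j mod ?n < ?n"
      using assms(2) by (auto intro!: mod_less_divisor)
    have "i = j \<or> i = Suc j mod ?n \<and> j = Suc i mod ?n"
      using eq i j less nth_eq_iff_index_eq[OF assms(1)]
      by (auto simp: doubleton_eq_iff)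
    then show "i = j"
      \<comment> \<open>two distinct indices that are cyclic successors of each other force \<open>n \<le> 2\<close>\<close>
      using i j assms(2) by (auto simp: mod_Suc split: if_splits)
  qed
  then show ?thesis
    by (simp add: cycle_length_def edges_cycle_graph_image card_image)
qed

lemma card_verts_cycle:
  assumes "is_cycle C"
  shows "card (verts C) = cycle_length C"
proof -
  obtain vs where vs: "distinct vs" "length vs \<ge> 3" "C = cycle_graph vs"
    using assms by (auto simp: is_cycle_def)
  then have "card (verts C) = length vs"
    by (simp add: cycle_graph_def distinct_card)
  with vs show ?thesis
    by (simp add: cycle_length_cycle_graph)
qed

lemma path_edge_subset_verts:
  assumes "is_path P u v" and "e \<in> edges P"
  shows "e \<subseteq> verts P"
  using assms by (auto simp: is_path_def path_graph_def)

definition close_path :: "'a \<Rightarrow> 'a \<Rightarrow> 'a \<Rightarrow> 'a graph \<Rightarrow> 'a graph" where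
  "close_path x u v P =
     \<lparr>verts = insert x (verts P), edges = insert {x, u} (insert {x, v} (edges P))\<rparr>"

lemma cycle_graph_Cons:
  assumes "vs \<noteq> []"
  shows "cycle_graph (x # vs) = close_path x (hd vs) (last vs) (path_graph vs)"
proof -
  let ?f = "\<lambda>i. {(x # vs) ! i, (x # vs) ! (Suc i mod length (x # vs))}"
  obtain m where m: "length vs = Suc m"
    using assms by (cases vs) auto
  \<comment> \<open>index \<open>0\<close> gives the edge leaving \<open>x\<close>, index \<open>m + 1\<close> the edge returning to \<open>x\<close>\<close>
  have indices: "{..<length (x # vs)} = insert 0 (insert (Suc m) (Suc ` {..<m}))"
    by (simp only: m list.size(4) add_Suc_right add_0_right One_nat_def
        lessThan_Suc_eq_insert_0[of "Suc m"] lessThan_Suc[of m] image_insert)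
  have first: "?f 0 = {x, hd vs}"
    using assms m by (simp add: hd_conv_nth)
  have last: "?f (Suc m) = {x, last vs}"
    using assms m by (auto simp: last_conv_nth)
  have middle: "?f ` Suc ` {..<m} = edges (path_graph vs)"
    by (auto simp: path_graph_def m image_iff)
  have "edges (cycle_graph (x # vs))
      = insert {x, hd vs} (insert {x, last vs} (edges (path_graph vs)))"
    unfolding edges_cycle_graph_image indices image_insert first last middle ..
  moreover have "verts (cycle_graph (x # vs)) = insert x (verts (path_graph vs))"
    by (simp add: cycle_graph_def path_graph_def)
  ultimately show ?thesis
    by (simp add: close_path_def)
qed

lemma close_path_eq_cycle_graph:
  assumes "is_path P u v" and "x \<notin> verts P" and "card (verts P) \<ge> 2"
  obtains ws where "distinct ws" "length ws = Suc (card (verts P))" "length ws \<ge> 3"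
    "close_path x u v P = cycle_graph ws"
proof -
  obtain vs where "vs \<noteq> []" "distinct vs" "hd vs = u" "last vs = v" "P = path_graph vs"
    using assms(1) by (auto simp: is_path_def)
  with assms(2,3) show thesis
    by (intro that[of "x # vs"])
       (auto simp: cycle_graph_Cons path_graph_def distinct_card)
qed

lemma is_cycle_close_path:
  assumes "is_path P u v" and "x \<notin> verts P" and "card (verts P) \<ge> 2"
  shows "is_cycle (close_path x u v P)"
  using close_path_eq_cycle_graph[OF assms] by (metis is_cycle_def)

lemma cycle_length_close_path:
  assumes "is_path P u v" and "x \<notin> verts P" and "card (verts P) \<ge> 2"
  shows "cycle_length (close_path x u v P) = Suc (card (verts P))"
  using close_path_eq_cycle_graph[OF assms] by (metis cycle_length_cycle_graph)

text \<open>
  The edges added at \<open>x\<close> are exactly the edges of the closed-up path that contain \<open>x\<close>, so removing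
  \<open>x\<close> gives back the path without knowing where its ends are.
\<close>

lemma close_path_inject:
  assumes "is_path P u v" and "is_path P' u' v'"
    and "x \<notin> verts P" and "x \<notin> verts P'"
    and eq: "close_path x u v P = close_path x u' v' P'"
  shows "P = P'"
proof (rule graph.equality)
  show "verts P = verts P'"
    using assms(3,4) eq by (auto simp: close_path_def)
  have "edges Q = {e \<in> edges (close_path x a b Q). x \<notin> e}"
    if "is_path Q a b" "x \<notin> verts Q" for Q a b
    using path_edge_subset_verts[OF that(1)] that(2) by (auto simp: close_path_def)
  then show "edges P = edges P'"
    using assms by metis
qed simp

lemma cycle_in_close_path:
  assumes "is_path P u v" and "subgraph P H" and "card (verts P) \<ge> 2"
    and "x \<in> verts H" and "x \<notin> verts P" and "{x, u} \<in> edges H" and "{x, v} \<in> edges H"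
  shows "cycle_in H (close_path x u v P)"
  using assms is_cycle_close_path[OF assms(1,5,3)]
  by (auto simp: cycle_in_def subgraph_def close_path_def)

theorem lemma7p10:
  fixes G C :: "'a graph" and R S :: "'a set" and x :: 'a
  assumes "simple_graph G"
    and "k_connected 2 G"
    and "uniquely_cycle_saturated 9 G"
    and "card (verts G) \<ge> 9"
    and "longest_even_cycle_upto 12 G C"
    and "cycle_length C = 8"
    and "R = verts G - verts C"
    and "x \<in> R"
    and "S = neighbours G x \<inter> verts C"
  shows "\<not> (\<exists>P. \<exists>s\<in>S. \<exists>t\<in>S. hamiltonian_path (induced G (verts C)) P s t) \<and>
    (\<forall>w \<in> verts C - S. \<exists>\<^sub>\<le>\<^sub>1 P. \<exists>s\<in>S. hamiltonian_path (induced G (verts C)) P w s)"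
proof -
  let ?ham = "hamiltonian_path (induced G (verts C))"
  have C: "is_cycle C" "verts C \<subseteq> verts G"
    using assms(5) by (auto simp: longest_even_cycle_upto_def cycle_in_def subgraph_def)
  have card_C: "card (verts C) = 8"
    using card_verts_cycle[OF C(1)] assms(6) by simp
  have x: "x \<in> verts G" "x \<notin> verts C"
    using assms(7,8) by auto
  have S: "{x, s} \<in> edges G" if "s \<in> S" for s
    using that assms(9) by (simp add: neighbours_def)
  have ham: "is_path P u v" "subgraph P G" "verts P = verts C" if "?ham P u v" for P u v
    using that C(2) by (auto simp: hamiltonian_path_def subgraph_def induced_def)
  have length_9: "cycle_length (close_path x u v P) = 9" if "?ham P u v" for P u v
    using cycle_length_close_path[OF ham(1)[OF that]] ham(3)[OF that] x(2) card_C by simp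

  have "\<not> ?ham P s t" if "s \<in> S" "t \<in> S" for P s t
  proof
    assume P: "?ham P s t"
    have "cycle_in G (close_path x s t P)"
      using cycle_in_close_path[OF ham(1,2)[OF P]] ham(3)[OF P] card_C x S that by simp
    with length_9[OF P] assms(3) show False
      by (auto simp: uniquely_cycle_saturated_def)
  qed
  moreover have "\<exists>\<^sub>\<le>\<^sub>1 P. \<exists>s\<in>S. ?ham P w s" if w: "w \<in> verts C - S" for w
  proof (rule Uniq_I, elim bexE)
    fix P P' s s'
    assume s: "s \<in> S" "s' \<in> S" and P: "?ham P w s" and P': "?ham P' w s'"
    let ?H = "add_edge G {x, w}"
    have "{x, w} \<in> edges (complement G)"
      using w x C(2) assms(9) by (auto simp: complement_def neighbours_def card_insert_if)
    then have unique: "\<exists>!D. cycle_in ?H D \<and> cycle_length D = 9"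
      using assms(3) by (simp add: uniquely_cycle_saturated_def)
    have cycle: "cycle_in ?H (close_path x w t Q)" if t: "t \<in> S" and Q: "?ham Q w t" for t Q
    proof (rule cycle_in_close_path[OF ham(1)[OF Q]])
      show "subgraph Q ?H"
        using ham(2)[OF Q] by (auto simp: subgraph_def add_edge_def)
    qed (use ham(3)[OF Q] card_C x S[OF t] in \<open>simp_all add: add_edge_def\<close>)
    have "close_path x w s P = close_path x w s' P'"
      using unique cycle[OF s(1) P] cycle[OF s(2) P'] length_9[OF P] length_9[OF P'] by blast
    then show "P = P'"
      using close_path_inject ham(1,3)[OF P] ham(1,3)[OF P'] x(2) by metis
  qed
  ultimately show ?thesis
    by blast
qed

end
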